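(* Let $K$ be a finite polyhedral complex in $\mathbb{R}^n$, in which some cells may be unbounded. Then $K$ is homotopy equivalent to a bounded polyhedral complex having no more cells than $K$ has.
   Context: A polyhedral complex in $\mathbb{R}^n$ is a finite collection of closed convex polyhedra (cells), closed under taking faces, such that any two cells intersect in a common face (possibly empty); it is identified with the union of its cells. *)

theory Defs
  imports "HOL-Analysis.Analysis"
begin

text \<open>A polyhedral complex: a finite collection of closed convex polyhedra (cells),
closed under taking faces, any two cells meeting in a common face (possibly empty).
Faces are in the sense of the library's face_of (which includes the empty set and
the cell itself).\<close>
definition polyhedral_complex :: "'a::euclidean_space set set \<Rightarrow> bool" where
  "polyhedral_complex K \<longleftrightarrow>
     finite K \<and>
     (\<forall>c\<in>K. polyhedron c) \<and>
     (\<forall>c\<in>K. \<forall>f. f face_of c \<longrightarrow> f \<in> K) \<and>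
     (\<forall>c1\<in>K. \<forall>c2\<in>K. (c1 \<inter> c2) face_of c1 \<and> (c1 \<inter> c2) face_of c2)"

end

theory Submission
  imports Defs
begin

text \<open>If the recession cone of a cell is not a linear subspace, then the cell retracts onto its
  relative frontier. A face of a cell whose recession cone is a subspace has the same recession
  cone. Hence an inclusion-maximal one among the cells whose recession cone is not a subspace is a
  proper face of no cell, and deleting it leaves a homotopy equivalent subcomplex. Once all
  recession cones are subspaces, cells that meet have the same recession cone, so cutting every
  cell with the orthogonal complement of its recession cone gives a complex of bounded cells, onto
  which the orthogonal projections retract the original one.\<close>

subsection \<open>Recession cones\<close>

definition recession_cone :: "'a::real_vector set \<Rightarrow> 'a set" where
  "recession_cone S = {v. \<forall>x\<in>S. \<forall>t\<ge>0. x + t *\<^sub>R v \<in> S}"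

lemma recession_coneD:
  "v \<in> recession_cone S \<Longrightarrow> x \<in> S \<Longrightarrow> 0 \<le> t \<Longrightarrow> x + t *\<^sub>R v \<in> S"
  by (simp add: recession_cone_def)

lemma add_mem_recession_cone:
  "x \<in> S \<Longrightarrow> v \<in> recession_cone S \<Longrightarrow> x + v \<in> S"
  using recession_coneD[of v S x 1] by simp

lemma recession_cone_scale:
  "v \<in> recession_cone S \<Longrightarrow> 0 \<le> c \<Longrightarrow> c *\<^sub>R v \<in> recession_cone S"
  by (simp add: recession_cone_def)

lemma subspace_recession_coneI:
  assumes "\<And>v. v \<in> recession_cone S \<Longrightarrow> - v \<in> recession_cone S"
  shows "subspace (recession_cone S)"
proof (rule subspaceI)
  show "0 \<in> recession_cone S"
    by (simp add: recession_cone_def)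
next
  fix v w assume "v \<in> recession_cone S" "w \<in> recession_cone S"
  then have "(x + t *\<^sub>R v) + t *\<^sub>R w \<in> S" if "x \<in> S" "t \<ge> 0" for x t
    using that by (intro recession_coneD)
  then show "v + w \<in> recession_cone S"
    by (simp add: recession_cone_def scaleR_add_right add.assoc)
next
  fix c v assume v: "v \<in> recession_cone S"
  then show "c *\<^sub>R v \<in> recession_cone S"
    using recession_cone_scale[OF v, of c] recession_cone_scale[OF assms[OF v], of "- c"]
    by (cases "c \<ge> 0") auto
qed

lemma recession_cone_limitI:
  fixes S :: "'a::real_normed_vector set"
  assumes "closed S" "convex S" and mem: "\<And>n. y n \<in> S" and nonneg: "\<And>n. 0 \<le> e n"
    and "e \<longlonglongrightarrow> 0" "(\<lambda>n. e n *\<^sub>R y n) \<longlonglongrightarrow> v"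
  shows "v \<in> recession_cone S"
  unfolding recession_cone_def
proof (intro CollectI ballI allI impI)
  fix x and t :: real
  assume "x \<in> S" "t \<ge> 0"
  define z where "z n = (1 - t * e n) *\<^sub>R x + (t * e n) *\<^sub>R y n" for n
  have "(\<lambda>n. t * e n) \<longlonglongrightarrow> t * 0"
    by (intro tendsto_intros assms)
  then have "\<forall>\<^sub>F n in sequentially. t * e n < 1"
    by (intro order_tendstoD) auto
  then have "\<forall>\<^sub>F n in sequentially. z n \<in> S"
  proof eventually_elim
    case (elim n)
    then show "z n \<in> S"
      unfolding z_def using \<open>x \<in> S\<close> \<open>t \<ge> 0\<close> mem nonneg by (intro convexD[OF \<open>convex S\<close>]) auto
  qed
  moreover have "(\<lambda>n. (1 - t * e n) *\<^sub>R x + t *\<^sub>R (e n *\<^sub>R y n)) \<longlonglongrightarrow> (1 - t * 0) *\<^sub>R x + t *\<^sub>R v"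
    by (intro tendsto_intros assms)
  then have "z \<longlonglongrightarrow> x + t *\<^sub>R v"
    by (simp add: z_def[abs_def])
  ultimately show "x + t *\<^sub>R v \<in> S"
    using Lim_in_closed_set[OF \<open>closed S\<close>] sequentially_bot by blast
qed

lemma recession_cone_rayI:
  fixes S :: "'a::real_normed_vector set"
  assumes "closed S" "convex S" and ray: "\<And>t. t \<ge> 0 \<Longrightarrow> x + t *\<^sub>R v \<in> S"
  shows "v \<in> recession_cone S"
proof (rule recession_cone_limitI[OF assms(1,2)])
  define e where "e n = inverse (real (Suc n))" for n
  show "e \<longlonglongrightarrow> 0"
    unfolding e_def by (rule LIMSEQ_inverse_real_of_nat)
  then have "(\<lambda>n. e n *\<^sub>R x + v) \<longlonglongrightarrow> 0 *\<^sub>R x + v"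
    by (intro tendsto_intros)
  then show "(\<lambda>n. e n *\<^sub>R (x + real (Suc n) *\<^sub>R v)) \<longlonglongrightarrow> v"
    by (simp add: e_def scaleR_add_right del: of_nat_Suc)
  show "x + real (Suc n) *\<^sub>R v \<in> S" for n
    by (intro ray) simp
  show "0 \<le> e n" for n
    by (simp add: e_def)
qed

lemma unbounded_closed_convex_recession:
  fixes S :: "'a::euclidean_space set"
  assumes "closed S" "convex S" "\<not> bounded S"
  obtains v where "v \<noteq> 0" "v \<in> recession_cone S"
proof -
  have "\<exists>y\<in>S. norm y > real (Suc n)" for n
    using assms(3) unfolding bounded_iff by (meson not_le)
  then obtain y where mem: "\<And>n. y n \<in> S" and norm_y: "\<And>n. norm (y n) > real (Suc n)"
    by metis
  define e where "e n = inverse (norm (y n))" for n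
  have "e n *\<^sub>R y n \<in> sphere 0 1" for n
  proof -
    have "y n \<noteq> 0"
      using norm_y[of n] by auto
    then show ?thesis
      by (simp add: e_def)
  qed
  then obtain v \<sigma> where v: "v \<in> sphere (0::'a) 1" and "strict_mono \<sigma>"
    and lim: "((\<lambda>n. e n *\<^sub>R y n) \<circ> \<sigma>) \<longlonglongrightarrow> v"
    using compact_sphere[of "0::'a" 1] unfolding compact_def by meson
  have "norm (e n) \<le> inverse (real (Suc n))" for n
    using norm_y[of n] by (auto simp: e_def intro!: le_imp_inverse_le)
  then have "e \<longlonglongrightarrow> 0"
    by (intro Lim_null_comparison[OF _ LIMSEQ_inverse_real_of_nat] always_eventually) blast
  then have "(e \<circ> \<sigma>) \<longlonglongrightarrow> 0"
    using \<open>strict_mono \<sigma>\<close> by (rule LIMSEQ_subseq_LIMSEQ)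
  then have "v \<in> recession_cone S"
    using assms(1,2) mem lim
    by (intro recession_cone_limitI[where y = "y \<circ> \<sigma>" and e = "e \<circ> \<sigma>"]) (auto simp: o_def e_def)
  moreover have "v \<noteq> 0"
    using v by auto
  ultimately show ?thesis
    using that by blast
qed

lemma recession_cone_inner_nonneg:
  fixes S :: "'a::real_inner set"
  assumes "v \<in> recession_cone S" "S \<noteq> {}" and bound: "\<And>x. x \<in> S \<Longrightarrow> b \<le> a \<bullet> x"
  shows "0 \<le> a \<bullet> v"
proof (rule ccontr)
  assume neg: "\<not> 0 \<le> a \<bullet> v"
  obtain x where x: "x \<in> S"
    using assms(2) by blast
  define t where "t = (a \<bullet> x - b + 1) / - (a \<bullet> v)"
  have "t * (a \<bullet> v) = b - a \<bullet> x - 1"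
    using neg by (simp add: t_def field_simps)
  moreover have "0 \<le> t"
    unfolding t_def using neg bound[OF x] by (intro divide_nonneg_nonneg) auto
  then have "b \<le> a \<bullet> (x + t *\<^sub>R v)"
    using assms(1) x by (intro bound recession_coneD)
  ultimately show False
    by (simp add: inner_add_right)
qed

lemma asymmetric_recession_functional:
  fixes S :: "'a::euclidean_space set"
  assumes "closed S" "convex S" "v \<in> recession_cone S" "- v \<notin> recession_cone S"
  obtains a b where "0 < a \<bullet> v" "\<And>x. x \<in> S \<Longrightarrow> b \<le> a \<bullet> x"
proof -
  obtain y t where y: "y \<in> S" "t \<ge> 0" "y - t *\<^sub>R v \<notin> S"
    using assms(4) by (auto simp: recession_cone_def)
  obtain a b where sep: "a \<bullet> (y - t *\<^sub>R v) < b" "\<And>x. x \<in> S \<Longrightarrow> b < a \<bullet> x"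
    using separating_hyperplane_closed_point[OF assms(2,1) y(3)] by blast
  have "a \<bullet> (y - t *\<^sub>R v) < a \<bullet> y"
    using sep(1) sep(2)[OF y(1)] by linarith
  then have "0 < a \<bullet> v"
    using y(2) by (simp add: inner_diff_right zero_less_mult_iff)
  then show ?thesis
    using sep(2) by (intro that[of a b]) (auto intro: less_imp_le)
qed

lemma rel_interior_add_recession_cone:
  fixes S :: "'a::euclidean_space set"
  assumes "convex S" "z \<in> rel_interior S" "v \<in> recession_cone S"
  shows "z + v \<in> rel_interior S"
proof (cases "v = 0")
  case False
  have "z + 2 *\<^sub>R v \<in> S"
    using assms(2) rel_interior_subset by (intro recession_coneD[OF assms(3)]) auto
  then have "z + 2 *\<^sub>R v \<in> closure S"
    using closure_subset by blast
  then have "open_segment z (z + 2 *\<^sub>R v) \<subseteq> rel_interior S"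
    by (rule rel_interior_closure_convex_segment[OF assms(1,2)])
  moreover have "midpoint z (z + 2 *\<^sub>R v) \<in> open_segment z (z + 2 *\<^sub>R v)"
    using False by simp
  moreover have "midpoint z (z + 2 *\<^sub>R v) = z + v"
    by (simp add: midpoint_eq_iff scaleR_2)
  ultimately show ?thesis
    by auto
qed (use assms(2) in simp)

lemma face_of_add_recession_cone:
  fixes S :: "'a::euclidean_space set"
  assumes "T face_of S" "x \<in> T" "v \<in> recession_cone S" "- v \<in> recession_cone S"
  shows "x + v \<in> T"
proof (cases "v = 0")
  case False
  have "x \<in> S"
    using assms(1,2) face_of_imp_subset by blast
  then have "x + v \<in> S" "x - v \<in> S"
    using add_mem_recession_cone[OF \<open>x \<in> S\<close>] assms(3,4) by force+
  moreover have "x - v \<noteq> x + v"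
  proof
    assume "x - v = x + v"
    then have "2 *\<^sub>R v = 0"
      by (simp add: scaleR_2 algebra_simps)
    with False show False by simp
  qed
  then have "midpoint (x - v) (x + v) \<in> open_segment (x - v) (x + v)"
    by simp
  then have "x \<in> open_segment (x - v) (x + v)"
    by (simp add: midpoint_def flip: scaleR_2)
  ultimately show ?thesis
    using face_ofD[OF assms(1)] assms(2) by blast
qed (use assms(2) in simp)

lemma recession_cone_face:
  fixes S :: "'a::euclidean_space set"
  assumes "closed S" "convex S" "T face_of S" "T \<noteq> {}" and sub: "subspace (recession_cone S)"
  shows "recession_cone T = recession_cone S"
proof
  obtain x where "x \<in> T"
    using assms(4) by blast
  then have "x + t *\<^sub>R v \<in> S" if "v \<in> recession_cone T" "t \<ge> 0" for v t
    using recession_coneD[OF that(1) _ that(2)] face_of_imp_subset[OF assms(3)] by blast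
  then show "recession_cone T \<subseteq> recession_cone S"
    using recession_cone_rayI[OF assms(1,2)] by blast
next
  show "recession_cone S \<subseteq> recession_cone T"
  proof
    fix v assume "v \<in> recession_cone S"
    then have "t *\<^sub>R v \<in> recession_cone S" "- (t *\<^sub>R v) \<in> recession_cone S" for t
      using sub by (auto intro: subspace_scale subspace_neg)
    then show "v \<in> recession_cone T"
      unfolding recession_cone_def[of T] using face_of_add_recession_cone[OF assms(3)] by blast
  qed
qed

subsection \<open>Retraction onto the relative frontier\<close>

lemma farthest_point_on_ray:
  fixes S :: "'a::real_normed_vector set"
  assumes "closed S" "convex S" "a \<in> S" "l \<notin> recession_cone S"
  obtains d where "0 \<le> d" "a + d *\<^sub>R l \<in> S" "\<And>e. d < e \<Longrightarrow> a + e *\<^sub>R l \<notin> S"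
proof -
  define E where "E = {e. 0 \<le> e \<and> a + e *\<^sub>R l \<in> S}"
  have "0 \<in> E"
    using assms(3) by (simp add: E_def)
  obtain t where t: "t \<ge> 0" "a + t *\<^sub>R l \<notin> S"
    using recession_cone_rayI[OF assms(1,2)] assms(4) by blast
  have "bdd_above E"
  proof (rule bdd_aboveI, rule ccontr)
    fix e assume e: "e \<in> E" "\<not> e \<le> t"
    then have "(1 - t / e) *\<^sub>R a + (t / e) *\<^sub>R (a + e *\<^sub>R l) \<in> S"
      using t(1) assms(3) by (intro convexD[OF assms(2)]) (auto simp: E_def)
    with e t show False
      by (simp add: algebra_simps)
  qed
  moreover have "closed E"
    unfolding E_def
    by (intro closed_Collect_conj closed_Collect_le closed_vimage[OF assms(1), unfolded vimage_def]
        continuous_intros)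
  ultimately have "Sup E \<in> E"
    using \<open>0 \<in> E\<close> by (intro closed_contains_Sup) auto
  moreover have "a + e *\<^sub>R l \<notin> S" if "Sup E < e" for e
  proof
    assume "a + e *\<^sub>R l \<in> S"
    then have "e \<in> E"
      using \<open>Sup E \<in> E\<close> that by (simp add: E_def)
    then have "e \<le> Sup E"
      using \<open>bdd_above E\<close> by (rule cSup_upper)
    with that show False by simp
  qed
  ultimately show ?thesis
    by (intro that[of "Sup E"]) (auto simp: E_def)
qed

lemma ray_exits_rel_frontier:
  fixes S :: "'a::euclidean_space set"
  assumes "closed S" "convex S" "a \<in> rel_interior S" "a + l \<in> affine hull S"
    and "l \<notin> recession_cone S"
  obtains d where "0 \<le> d" "a + d *\<^sub>R l \<in> rel_frontier S"
    "\<And>e. 0 \<le> e \<Longrightarrow> e < d \<Longrightarrow> a + e *\<^sub>R l \<in> rel_interior S"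
    "\<And>e. d < e \<Longrightarrow> a + e *\<^sub>R l \<notin> S"
proof -
  have "a \<in> S"
    using assms(3) rel_interior_subset by blast
  then obtain d where d: "0 \<le> d" "a + d *\<^sub>R l \<in> S" "\<And>e. d < e \<Longrightarrow> a + e *\<^sub>R l \<notin> S"
    using farthest_point_on_ray[OF assms(1,2) _ assms(5)] by blast
  have "a + d *\<^sub>R l \<notin> rel_interior S"
  proof
    assume z: "a + d *\<^sub>R l \<in> rel_interior S"
    have "a + (d - 1) *\<^sub>R ((a + l) - a) \<in> affine hull S"
      using \<open>a \<in> S\<close> assms(4) by (intro mem_affine_3_minus) (auto simp: hull_inc)
    then obtain e where "e > 1"
      and e: "(1 - e) *\<^sub>R (a + (d - 1) *\<^sub>R ((a + l) - a)) + e *\<^sub>R (a + d *\<^sub>R l) \<in> S"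
      using convex_rel_interior_if2[OF assms(2) z] by blast
    have "a + (d + (e - 1)) *\<^sub>R l \<in> S"
      using e by (simp add: algebra_simps)
    then show False
      using d(3)[of "d + (e - 1)"] \<open>e > 1\<close> by simp
  qed
  then have "a + d *\<^sub>R l \<in> rel_frontier S"
    using d(2) closure_subset by (auto simp: rel_frontier_def)
  moreover have "a + e *\<^sub>R l \<in> rel_interior S" if "0 \<le> e" "e < d" for e
  proof -
    have "a + d *\<^sub>R l - (1 - e / d) *\<^sub>R (a + d *\<^sub>R l - a) \<in> rel_interior S"
      using that d(2) by (intro rel_interior_convex_shrink[OF assms(2,3)]) auto
    also have "a + d *\<^sub>R l - (1 - e / d) *\<^sub>R (a + d *\<^sub>R l - a) = a + e *\<^sub>R l"
      using that by (simp add: left_diff_distrib scaleR_diff_left)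
    finally show ?thesis .
  qed
  ultimately show ?thesis
    using d(1,3) by (intro that[of d])
qed

lemma eventually_mem_rel_interior:
  fixes S :: "'a::euclidean_space set"
  assumes "(f \<longlongrightarrow> a) F" "a \<in> rel_interior S" "\<forall>\<^sub>F y in F. f y \<in> affine hull S"
  shows "\<forall>\<^sub>F y in F. f y \<in> rel_interior S"
proof -
  obtain U where U: "open U" "rel_interior S = affine hull S \<inter> U"
    using openin_rel_interior[of S] by (auto simp: openin_open)
  then have "\<forall>\<^sub>F y in F. f y \<in> U"
    using assms(2) by (intro topological_tendstoD[OF assms(1)]) auto
  with assms(3) show ?thesis
    by eventually_elim (simp add: U(2))
qed

lemma continuous_on_exit_time:
  fixes S :: "'a::euclidean_space set" and T :: "'b::topological_space set"
  assumes "closed S" "continuous_on T p" "continuous_on T l"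
    and aff: "\<And>x e. x \<in> T \<Longrightarrow> p x + e *\<^sub>R l x \<in> affine hull S"
    and nonneg: "\<And>x. x \<in> T \<Longrightarrow> 0 \<le> d x"
    and before: "\<And>x e. x \<in> T \<Longrightarrow> 0 \<le> e \<Longrightarrow> e < d x \<Longrightarrow> p x + e *\<^sub>R l x \<in> rel_interior S"
    and after: "\<And>x e. x \<in> T \<Longrightarrow> d x < e \<Longrightarrow> p x + e *\<^sub>R l x \<notin> S"
  shows "continuous_on T d"
  unfolding continuous_on_def
proof
  fix x assume x: "x \<in> T"
  have lim: "((\<lambda>y. p y + e *\<^sub>R l y) \<longlongrightarrow> p x + e *\<^sub>R l x) (at x within T)" for e
    using assms(2,3) x unfolding continuous_on_def by (intro tendsto_intros) auto
  have mem_T: "\<forall>\<^sub>F y in at x within T. y \<in> T"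
    by (simp add: eventually_at_filter)
  have "\<forall>\<^sub>F y in at x within T. a < d y" if "a < d x" for a
  proof (cases "a < 0")
    case True
    show ?thesis
      using mem_T by eventually_elim (use True nonneg in force)
  next
    case False
    then obtain e where e: "0 \<le> e" "a < e" "e < d x"
      using dense[OF \<open>a < d x\<close>] by force
    have "\<forall>\<^sub>F y in at x within T. p y + e *\<^sub>R l y \<in> rel_interior S"
      using lim before[OF x e(1,3)] eventually_mono[OF mem_T aff]
      by (rule eventually_mem_rel_interior)
    with mem_T show ?thesis
    proof eventually_elim
      case (elim y)
      then have "p y + e *\<^sub>R l y \<in> S"
        using rel_interior_subset by blast
      then show ?case
        using after[OF \<open>y \<in> T\<close>, of e] e(2) by force
    qed
  qed
  moreover have "\<forall>\<^sub>F y in at x within T. d y < a" if "d x < a" for a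
  proof -
    obtain e where e: "d x < e" "e < a"
      using dense[OF \<open>d x < a\<close>] by blast
    have "\<forall>\<^sub>F y in at x within T. p y + e *\<^sub>R l y \<in> - S"
      using assms(1) after[OF x e(1)] by (intro topological_tendstoD[OF lim]) auto
    with mem_T show ?thesis
    proof eventually_elim
      case (elim y)
      then have "p y + e *\<^sub>R l y \<notin> rel_interior S"
        using rel_interior_subset by blast
      then show ?case
        using before[OF \<open>y \<in> T\<close>, of e] nonneg[OF x] e by force
    qed
  qed
  ultimately show "(d \<longlongrightarrow> d x) (at x within T)"
    by (rule order_tendstoI)
qed

text \<open>Each \<open>x\<close> is projected from its own centre \<open>p x\<close>, since no single centre sends all the
  rays out of an unbounded set.\<close>

lemma rel_frontier_retract_of_moving_centre:
  fixes S :: "'a::euclidean_space set"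
  assumes "closed S" "convex S" "continuous_on S p"
    and centre: "\<And>x. x \<in> S \<Longrightarrow> p x \<in> rel_interior S"
    and leaves: "\<And>x. x \<in> S \<Longrightarrow> x - p x \<notin> recession_cone S"
  shows "rel_frontier S retract_of S"
proof -
  have frontier: "rel_frontier S = S - rel_interior S"
    using assms(1) by (simp add: rel_frontier_def)
  have "\<exists>d\<ge>0. p x + d *\<^sub>R (x - p x) \<in> rel_frontier S \<and>
      (\<forall>e. 0 \<le> e \<longrightarrow> e < d \<longrightarrow> p x + e *\<^sub>R (x - p x) \<in> rel_interior S) \<and>
      (\<forall>e>d. p x + e *\<^sub>R (x - p x) \<notin> S)" if "x \<in> S" for x
  proof -
    have "p x + (x - p x) \<in> affine hull S"
      using that by (simp add: hull_inc)
    from ray_exits_rel_frontier[OF assms(1,2) centre[OF that] this leaves[OF that]]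
    show ?thesis by metis
  qed
  then obtain d where d_nonneg: "\<And>x. x \<in> S \<Longrightarrow> 0 \<le> d x"
      and d_frontier: "\<And>x. x \<in> S \<Longrightarrow> p x + d x *\<^sub>R (x - p x) \<in> rel_frontier S"
      and before: "\<And>x e. x \<in> S \<Longrightarrow> 0 \<le> e \<Longrightarrow> e < d x \<Longrightarrow> p x + e *\<^sub>R (x - p x) \<in> rel_interior S"
      and after: "\<And>x e. x \<in> S \<Longrightarrow> d x < e \<Longrightarrow> p x + e *\<^sub>R (x - p x) \<notin> S"
    by metis
  have "p x + e *\<^sub>R (x - p x) \<in> affine hull S" if "x \<in> S" for x e
    using that centre[OF that] rel_interior_subset
    by (intro mem_affine_3_minus) (auto intro: hull_inc)
  then have "continuous_on S d"
    using assms(1,3) d_nonneg before after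
    by (intro continuous_on_exit_time[where l = "\<lambda>x. x - p x"] continuous_intros)
  then have "continuous_on S (\<lambda>x. p x + d x *\<^sub>R (x - p x))"
    using assms(3) by (intro continuous_intros)
  moreover have "p x + d x *\<^sub>R (x - p x) = x" if "x \<in> rel_frontier S" for x
  proof -
    have "x \<in> S" "x \<notin> rel_interior S"
      using that by (simp_all add: frontier)
    then have "d x = 1"
      using before[of x 1] after[of x 1] by force
    then show ?thesis by simp
  qed
  moreover have "rel_frontier S \<subseteq> S"
    by (auto simp: frontier)
  ultimately have "retraction S (rel_frontier S) (\<lambda>x. p x + d x *\<^sub>R (x - p x))"
    using d_frontier by (simp add: retraction_def)
  then show ?thesis
    by (auto simp: retract_of_def)
qed

text \<open>The centre lies so far out in an irreversible recession direction \<open>v\<close> that a functional \<open>a\<close>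
  that is bounded below on \<open>S\<close> decreases from the centre to \<open>x\<close>.\<close>

lemma rel_frontier_retract_of_asymmetric_recession:
  fixes S :: "'a::euclidean_space set"
  assumes "closed S" "convex S" "\<not> subspace (recession_cone S)"
  shows "rel_frontier S retract_of S"
proof -
  obtain v where v: "v \<in> recession_cone S" "- v \<notin> recession_cone S"
    using assms(3) subspace_recession_coneI by blast
  obtain a b where av_pos: "0 < a \<bullet> v" and bound: "\<And>x. x \<in> S \<Longrightarrow> b \<le> a \<bullet> x"
    using asymmetric_recession_functional[OF assms(1,2) v] by blast
  have "S \<noteq> {}"
    using v(2) by (auto simp: recession_cone_def)
  then obtain z where z: "z \<in> rel_interior S"
    using rel_interior_eq_empty[OF assms(2)] by blast
  define s where "s x = (1 + \<bar>a \<bullet> x - a \<bullet> z\<bar>) / (a \<bullet> v)" for x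
  define p where "p x = z + s x *\<^sub>R v" for x
  show ?thesis
  proof (rule rel_frontier_retract_of_moving_centre[OF assms(1,2)])
    show "continuous_on S p"
      unfolding p_def s_def using av_pos by (intro continuous_intros) auto
    show "p x \<in> rel_interior S" for x
      unfolding p_def using av_pos v(1) assms(2) z
      by (intro rel_interior_add_recession_cone recession_cone_scale) (auto simp: s_def)
    have "a \<bullet> (x - p x) < 0" for x
      using av_pos by (simp add: p_def s_def inner_diff_right inner_add_right)
    then show "x - p x \<notin> recession_cone S" for x
      using recession_cone_inner_nonneg[OF _ \<open>S \<noteq> {}\<close> bound] by (meson not_le)
  qed
qed

subsection \<open>Deformation retractions along segments\<close>

lemma retraction_UN_closed:
  assumes "finite I" and closed: "\<And>i. i \<in> I \<Longrightarrow> closed (S i)"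
    and r: "\<And>i. i \<in> I \<Longrightarrow> retraction (S i) (T i) (r i)"
    and agree: "\<And>i j x. i \<in> I \<Longrightarrow> j \<in> I \<Longrightarrow> x \<in> S i \<inter> S j \<Longrightarrow> r i x = r j x"
  obtains g where "retraction (\<Union>i\<in>I. S i) (\<Union>i\<in>I. T i) g"
    "\<And>i x. i \<in> I \<Longrightarrow> x \<in> S i \<Longrightarrow> g x = r i x"
proof -
  let ?S = "\<Union>i\<in>I. S i" and ?T = "\<Union>i\<in>I. T i"
  have T_subset: "T i \<subseteq> S i" and r_cont: "continuous_on (S i) (r i)"
    and r_mem: "x \<in> S i \<Longrightarrow> r i x \<in> T i" and r_id: "x \<in> T i \<Longrightarrow> r i x = x"
    if "i \<in> I" for i x
    using r[OF that] by (auto simp: retraction_def)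
  have "closedin (top_of_set ?S) (S i)" if "i \<in> I" for i
    using that closed by (intro closed_subset) auto
  moreover have "continuous_map (subtopology (top_of_set ?S) (S i)) euclidean (r i)"
    if "i \<in> I" for i
    using that r_cont by (simp add: subtopology_subtopology inf_absorb2 UN_upper)
  moreover have "r i x = r j x" if "i \<in> I" "j \<in> I" "x \<in> topspace (top_of_set ?S) \<inter> S i \<inter> S j"
    for i j x
    using that by (intro agree) auto
  ultimately obtain g where cont: "continuous_map (top_of_set ?S) euclidean g"
    and g: "\<And>x i. i \<in> I \<Longrightarrow> x \<in> topspace (top_of_set ?S) \<inter> S i \<Longrightarrow> g x = r i x"
    using pasting_lemma_exists_closed[OF \<open>finite I\<close>, of "top_of_set ?S" S euclidean r]
    unfolding topspace_euclidean_subtopology by (metis order_refl)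
  have g_eq: "g x = r i x" if "i \<in> I" "x \<in> S i" for i x
    using g[OF that(1)] that by auto
  have "g x \<in> ?T" if x: "x \<in> ?S" for x
  proof -
    obtain i where "i \<in> I" "x \<in> S i"
      using x by blast
    then show ?thesis
      using r_mem by (auto simp: g_eq)
  qed
  moreover have "g x = x" if x: "x \<in> ?T" for x
  proof -
    obtain i where i: "i \<in> I" "x \<in> T i"
      using x by blast
    with T_subset[OF i(1)] show ?thesis
      by (simp add: g_eq[OF i(1)] subsetD r_id)
  qed
  moreover have "?T \<subseteq> ?S"
    using T_subset by (rule UN_mono[OF order_refl])
  ultimately have "retraction ?S ?T g"
    using cont by (simp add: retraction_def)
  then show ?thesis
    using g_eq by (rule that)
qed

lemma homotopy_eqv_UN_retraction:
  fixes S :: "'i \<Rightarrow> 'a::euclidean_space set"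
  assumes "finite I" "\<And>i. i \<in> I \<Longrightarrow> closed (S i)"
    and "\<And>i. i \<in> I \<Longrightarrow> retraction (S i) (T i) (r i)"
    and segment: "\<And>i x. i \<in> I \<Longrightarrow> x \<in> S i \<Longrightarrow> closed_segment x (r i x) \<subseteq> S i"
    and "\<And>i j x. i \<in> I \<Longrightarrow> j \<in> I \<Longrightarrow> x \<in> S i \<inter> S j \<Longrightarrow> r i x = r j x"
  shows "(\<Union>i\<in>I. S i) homotopy_eqv (\<Union>i\<in>I. T i)"
proof -
  let ?S = "\<Union>i\<in>I. S i"
  obtain g where g: "retraction ?S (\<Union>i\<in>I. T i) g" "\<And>i x. i \<in> I \<Longrightarrow> x \<in> S i \<Longrightarrow> g x = r i x"
    using retraction_UN_closed[of I S T r, OF assms(1-3,5)] by blast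
  have "homotopic_with_canon (\<lambda>x. True) ?S ?S id g"
  proof (rule homotopic_with_linear)
    show "continuous_on ?S g"
      using g(1) by (simp add: retraction_def)
    fix x assume "x \<in> ?S"
    then obtain i where i: "i \<in> I" "x \<in> S i" by blast
    then have "closed_segment x (g x) \<subseteq> S i"
      using segment by (simp add: g(2))
    with i(1) show "closed_segment (id x) (g x) \<subseteq> ?S" by auto
  qed (simp add: continuous_on_id)
  then show ?thesis
    using g(1) by (rule deformation_retract_imp_homotopy_eqv)
qed

lemma homotopy_eqv_convex_Un:
  fixes C :: "'a::euclidean_space set"
  assumes "closed C" "convex C" "closed T" "C \<inter> T retract_of C"
  shows "C \<union> T homotopy_eqv T"
proof -
  obtain r where r: "retraction C (C \<inter> T) r"
    using assms(4) by (auto simp: retract_of_def)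
  then have r_mem: "r x \<in> C" and r_id: "x \<in> T \<Longrightarrow> r x = x" if "x \<in> C" for x
    using that by (auto simp: retraction_def)
  have "(\<Union>b. if b then C else T) homotopy_eqv (\<Union>b. if b then C \<inter> T else T)"
  proof (rule homotopy_eqv_UN_retraction[where r = "\<lambda>b. if b then r else id"])
    show "closed (if b then C else T)" for b
      using assms(1,3) by simp
    show "retraction (if b then C else T) (if b then C \<inter> T else T) (if b then r else id)" for b
      using r by (simp add: retraction_def)
    show "closed_segment x ((if b then r else id) x) \<subseteq> (if b then C else T)"
      if "x \<in> (if b then C else T)" for b x
      using that r_mem assms(2) by (cases b) (simp_all add: closed_segment_subset)
    show "(if b then r else id) x = (if b' then r else id) x"
      if "x \<in> (if b then C else T) \<inter> (if b' then C else T)" for b b' x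
      using that r_id by (cases b; cases b') simp_all
  qed simp
  then show ?thesis
    unfolding UN_bool_eq by (simp add: Un_absorb1)
qed

subsection \<open>Deleting cells\<close>

lemma
  assumes "polyhedral_complex K"
  shows polyhedral_complex_finite: "finite K"
    and polyhedral_complex_polyhedron: "c \<in> K \<Longrightarrow> polyhedron c"
    and polyhedral_complex_closed_convex: "c \<in> K \<Longrightarrow> closed c" "c \<in> K \<Longrightarrow> convex c"
    and polyhedral_complex_face: "c \<in> K \<Longrightarrow> f face_of c \<Longrightarrow> f \<in> K"
    and polyhedral_complex_Int_face: "c \<in> K \<Longrightarrow> d \<in> K \<Longrightarrow> c \<inter> d face_of c"
      "c \<in> K \<Longrightarrow> d \<in> K \<Longrightarrow> c \<inter> d face_of d"
  using assms
  by (auto simp: polyhedral_complex_def polyhedron_imp_closed polyhedron_imp_convex)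

definition maximal_cell :: "'a::euclidean_space set set \<Rightarrow> 'a set \<Rightarrow> bool" where
  "maximal_cell K c \<longleftrightarrow> c \<in> K \<and> (\<forall>d\<in>K. c face_of d \<longrightarrow> d = c)"

lemma polyhedral_complex_remove_maximal_cell:
  assumes K: "polyhedral_complex K" and max: "maximal_cell K c"
  shows "polyhedral_complex (K - {c})"
  unfolding polyhedral_complex_def
proof (intro conjI ballI allI impI)
  show "finite (K - {c})"
    using polyhedral_complex_finite[OF K] by simp
next
  fix d assume d: "d \<in> K - {c}"
  then show "polyhedron d"
    using polyhedral_complex_polyhedron[OF K] by simp
  fix f assume f: "f face_of d"
  then have "f \<noteq> c"
    using max d by (auto simp: maximal_cell_def)
  moreover have "f \<in> K"
    using polyhedral_complex_face[OF K _ f] d by simp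
  ultimately show "f \<in> K - {c}" by simp
next
  fix d1 d2 assume "d1 \<in> K - {c}" "d2 \<in> K - {c}"
  then have "d1 \<in> K" "d2 \<in> K"
    by simp_all
  then show "d1 \<inter> d2 face_of d1" "d1 \<inter> d2 face_of d2"
    by (rule polyhedral_complex_Int_face[OF K])+
qed

lemma maximal_cell_Int_Union:
  assumes K: "polyhedral_complex K" and maximal: "maximal_cell K c"
  shows "c \<inter> \<Union>(K - {c}) = rel_frontier c"
proof
  have "c \<in> K" and max: "\<And>d. d \<in> K \<Longrightarrow> c face_of d \<Longrightarrow> d = c"
    using maximal by (auto simp: maximal_cell_def)
  show "c \<inter> \<Union>(K - {c}) \<subseteq> rel_frontier c"
  proof
    fix x assume "x \<in> c \<inter> \<Union>(K - {c})"
    then obtain d where d: "d \<in> K" "d \<noteq> c" "x \<in> c \<inter> d"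
      by blast
    then have "c \<inter> d \<noteq> c"
      using max[OF d(1)] polyhedral_complex_Int_face(2)[OF K \<open>c \<in> K\<close> d(1)] by metis
    with polyhedral_complex_Int_face(1)[OF K \<open>c \<in> K\<close> d(1)] have "c \<inter> d \<subseteq> rel_frontier c"
      by (rule face_of_subset_rel_frontier)
    with d(3) show "x \<in> rel_frontier c" by blast
  qed
  show "rel_frontier c \<subseteq> c \<inter> \<Union>(K - {c})"
    unfolding rel_frontier_of_polyhedron_alt[OF polyhedral_complex_polyhedron[OF K \<open>c \<in> K\<close>]]
    using polyhedral_complex_face[OF K \<open>c \<in> K\<close>] face_of_imp_subset by blast
qed

lemma homotopy_eqv_remove_maximal_cell:
  assumes K: "polyhedral_complex K" and max: "maximal_cell K c"
    and asym: "\<not> subspace (recession_cone c)"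
  shows "\<Union>K homotopy_eqv \<Union>(K - {c})"
proof -
  have "c \<in> K"
    using max by (simp add: maximal_cell_def)
  note closed_convex = polyhedral_complex_closed_convex[OF K \<open>c \<in> K\<close>]
  have "closed (\<Union>(K - {c}))"
    using polyhedral_complex_finite[OF K] polyhedral_complex_closed_convex(1)[OF K]
    by (intro closed_Union) auto
  moreover have "c \<inter> \<Union>(K - {c}) retract_of c"
    using rel_frontier_retract_of_asymmetric_recession[OF closed_convex asym]
    by (simp add: maximal_cell_Int_Union[OF K max])
  ultimately have "c \<union> \<Union>(K - {c}) homotopy_eqv \<Union>(K - {c})"
    by (rule homotopy_eqv_convex_Un[OF closed_convex])
  moreover have "c \<union> \<Union>(K - {c}) = \<Union>K"
    using \<open>c \<in> K\<close> by blast
  ultimately show ?thesis by simp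
qed

lemma maximal_asymmetric_cell_exists:
  assumes K: "polyhedral_complex K" and "c \<in> K" "\<not> subspace (recession_cone c)"
  obtains m where "maximal_cell K m" "\<not> subspace (recession_cone m)"
proof -
  define B where "B = {c \<in> K. \<not> subspace (recession_cone c)}"
  have "finite B" "c \<in> B"
    using polyhedral_complex_finite[OF K] assms(2,3) by (simp_all add: B_def)
  then obtain m where m_in_B: "m \<in> B" and m_max: "\<And>d. d \<in> B \<Longrightarrow> m \<subseteq> d \<Longrightarrow> m = d"
    using finite_has_maximal2[of B c] by blast
  have "m \<noteq> {}"
    using m_in_B by (auto simp: B_def recession_cone_def)
  have "d = m" if d: "d \<in> K" "m face_of d" for d
  proof -
    have "d \<in> B"
      using recession_cone_face[OF polyhedral_complex_closed_convex[OF K d(1)] d(2) \<open>m \<noteq> {}\<close>]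
        m_in_B d(1)
      by (auto simp: B_def)
    then show ?thesis
      using m_max face_of_imp_subset[OF d(2)] by blast
  qed
  then have "maximal_cell K m"
    using m_in_B by (auto simp: maximal_cell_def B_def)
  then show ?thesis
    using m_in_B that by (auto simp: B_def)
qed

lemma homotopy_eqv_subcomplex_subspace_recession:
  assumes K: "polyhedral_complex K"
  obtains M where "M \<subseteq> K" "polyhedral_complex M" "\<Union>K homotopy_eqv \<Union>M"
    "\<And>c. c \<in> M \<Longrightarrow> subspace (recession_cone c)"
proof -
  define \<M> where "\<M> = {M. M \<subseteq> K \<and> polyhedral_complex M \<and> \<Union>K homotopy_eqv \<Union>M}"
  have "finite \<M>" "K \<in> \<M>"
    using polyhedral_complex_finite[OF K] K homotopy_equivalent_space_refl by (auto simp: \<M>_def)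
  then obtain M where M: "M \<in> \<M>" and min: "\<And>N. N \<in> \<M> \<Longrightarrow> N \<subseteq> M \<Longrightarrow> M = N"
    using finite_has_minimal2[of \<M> K] by blast
  then have cplx: "polyhedral_complex M"
    by (simp add: \<M>_def)
  have "subspace (recession_cone c)" if c: "c \<in> M" for c
  proof (rule ccontr)
    assume "\<not> subspace (recession_cone c)"
    then obtain m where m: "maximal_cell M m" "\<not> subspace (recession_cone m)"
      using maximal_asymmetric_cell_exists[OF cplx c] by blast
    have "\<Union>K homotopy_eqv \<Union>(M - {m})"
      using M homotopy_eqv_remove_maximal_cell[OF cplx m]
      by (auto simp: \<M>_def intro: homotopy_eqv_trans)
    then have "M - {m} \<in> \<M>"
      using M polyhedral_complex_remove_maximal_cell[OF cplx m(1)] by (auto simp: \<M>_def)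
    then have "M = M - {m}"
      by (rule min) blast
    with m(1) show False
      by (auto simp: maximal_cell_def)
  qed
  with M show ?thesis
    by (intro that[of M]) (auto simp: \<M>_def)
qed

subsection \<open>Orthogonal sections of cells\<close>

lemma closest_point_in_subspace:
  fixes V :: "'a::euclidean_space set"
  shows "subspace V \<Longrightarrow> closest_point V x \<in> V"
  using subspace_0 by (intro closest_point_in_set closed_subspace) auto

lemma diff_closest_point_subspace:
  fixes V :: "'a::euclidean_space set"
  assumes V: "subspace V"
  shows "x - closest_point V x \<in> V\<^sup>\<bottom>"
proof -
  let ?c = "closest_point V x"
  have "?c \<in> V"
    using V by (rule closest_point_in_subspace)
  have nonpos: "(x - ?c) \<bullet> v \<le> 0" if "v \<in> V" for v
    using closest_point_dot[of V "?c + v" x] V that \<open>?c \<in> V\<close>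
    by (simp add: subspace_add subspace_imp_convex closed_subspace)
  have "(x - ?c) \<bullet> v = 0" if "v \<in> V" for v
    using nonpos[OF that] nonpos[of "- v"] subspace_neg[OF V that] by simp
  then show ?thesis
    by (simp add: orthogonal_comp_def orthogonal_def inner_commute)
qed

lemma closest_point_subspace_eqI:
  fixes V :: "'a::euclidean_space set"
  assumes V: "subspace V" and y: "y \<in> V" "x - y \<in> V\<^sup>\<bottom>"
  shows "closest_point V x = y"
proof -
  let ?c = "closest_point V x"
  have "?c - y \<in> V"
    using V closest_point_in_subspace[OF V] y(1) by (rule subspace_diff)
  moreover have "(x - y) - (x - ?c) \<in> V\<^sup>\<bottom>"
    by (rule subspace_diff[OF subspace_orthogonal_comp y(2) diff_closest_point_subspace[OF V]])
  ultimately have "?c - y \<in> V \<inter> V\<^sup>\<bottom>"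
    by simp
  then show ?thesis
    by (simp add: orthogonal_Int_0[OF V])
qed

lemma linear_closest_point_subspace:
  fixes V :: "'a::euclidean_space set"
  assumes V: "subspace V"
  shows "linear (closest_point V)"
proof -
  note perp = subspace_orthogonal_comp[of V] diff_closest_point_subspace[OF V]
  show ?thesis
  proof (rule linearI; rule closest_point_subspace_eqI[OF V])
    fix x y
    have "(x - closest_point V x) + (y - closest_point V y) \<in> V\<^sup>\<bottom>"
      by (intro subspace_add perp)
    then show "x + y - (closest_point V x + closest_point V y) \<in> V\<^sup>\<bottom>"
      by (simp add: algebra_simps)
  next
    fix c x
    have "c *\<^sub>R (x - closest_point V x) \<in> V\<^sup>\<bottom>"
      by (intro subspace_scale perp)
    then show "c *\<^sub>R x - c *\<^sub>R closest_point V x \<in> V\<^sup>\<bottom>"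
      by (simp add: scaleR_diff_right)
  qed (intro subspace_add subspace_scale closest_point_in_subspace V)+
qed

lemma face_of_linear_vimage:
  assumes f: "linear f" and "convex S" "f ` S \<subseteq> R" and T: "T face_of R"
  shows "S \<inter> f -` T face_of S"
  unfolding face_of_def
proof (intro conjI ballI impI)
  show "convex (S \<inter> f -` T)"
    using assms(2) face_of_imp_convex[OF T] by (intro convex_Int convex_linear_vimage f)
  fix u v x
  assume u: "u \<in> S" and v: "v \<in> S" and x: "x \<in> S \<inter> f -` T" and "x \<in> open_segment u v"
  then obtain t where t: "0 < t" "t < 1" "x = (1 - t) *\<^sub>R u + t *\<^sub>R v"
    by (auto simp: in_segment)
  then have fx: "f x = (1 - t) *\<^sub>R f u + t *\<^sub>R f v"
    using f by (simp add: linear_add linear_scale)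
  have "f u \<in> T \<and> f v \<in> T"
  proof (cases "f u = f v")
    case True
    with fx x show ?thesis
      by (simp flip: scaleR_add_left)
  next
    case False
    with t(1,2) fx have "f x \<in> open_segment (f u) (f v)"
      by (auto simp: in_segment)
    then show ?thesis
      using face_ofD[OF T] u v x assms(3) by blast
  qed
  then show "u \<in> S \<inter> f -` T" "v \<in> S \<inter> f -` T"
    using u v by auto
qed simp

definition recession_section :: "'a::euclidean_space set \<Rightarrow> 'a set" where
  "recession_section S = S \<inter> (recession_cone S)\<^sup>\<bottom>"

lemma recession_section_subset: "recession_section S \<subseteq> S"
  by (simp add: recession_section_def)

lemma convex_recession_section:
  "convex S \<Longrightarrow> convex (recession_section S)"
  by (simp add: recession_section_def convex_Int subspace_imp_convex subspace_orthogonal_comp)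

lemma polyhedron_recession_section:
  "polyhedron S \<Longrightarrow> polyhedron (recession_section S)"
  by (simp add: recession_section_def affine_imp_polyhedron subspace_imp_affine
      subspace_orthogonal_comp)

lemma bounded_recession_section:
  assumes "closed S" "convex S"
  shows "bounded (recession_section S)"
proof (rule ccontr)
  let ?T = "recession_section S"
  note perp = subspace_orthogonal_comp[of "recession_cone S"]
  assume "\<not> bounded ?T"
  moreover have "closed ?T"
    unfolding recession_section_def using assms(1) closed_subspace[OF perp] by (rule closed_Int)
  ultimately obtain v where v: "v \<noteq> 0" "v \<in> recession_cone ?T"
    using unbounded_closed_convex_recession convex_recession_section[OF assms(2)] by blast
  obtain x where x: "x \<in> ?T"
    using \<open>\<not> bounded ?T\<close> by force
  then have ray: "x + t *\<^sub>R v \<in> ?T" if "t \<ge> 0" for t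
    using v(2) that by (intro recession_coneD)
  then have "v \<in> recession_cone S"
    using recession_section_subset by (intro recession_cone_rayI[OF assms]) blast
  moreover have "(x + 1 *\<^sub>R v) - x \<in> (recession_cone S)\<^sup>\<bottom>"
    using ray[of 1] x by (intro subspace_diff[OF perp]) (auto simp: recession_section_def)
  ultimately have "orthogonal v v"
    by (simp add: orthogonal_comp_def)
  with v(1) show False
    by (simp add: orthogonal_def)
qed

lemma retraction_recession_section:
  assumes sub: "subspace (recession_cone S)"
  shows "retraction S (recession_section S) (closest_point ((recession_cone S)\<^sup>\<bottom>))"
proof -
  let ?V = "(recession_cone S)\<^sup>\<bottom>"
  have V: "subspace ?V" "closed ?V" "?V \<noteq> {}"
    using subspace_orthogonal_comp[of "recession_cone S"] closed_subspace subspace_0 by blast+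
  have "closest_point ?V x \<in> S" if "x \<in> S" for x
  proof -
    have "x - closest_point ?V x \<in> recession_cone S"
      using diff_closest_point_subspace[OF V(1)] by (simp add: orthogonal_comp_self[OF sub])
    then have "x + - (x - closest_point ?V x) \<in> S"
      using sub that by (intro add_mem_recession_cone subspace_neg)
    then show ?thesis by simp
  qed
  moreover have "continuous_on S (closest_point ?V)"
    using V by (intro continuous_on_closest_point subspace_imp_convex)
  ultimately show ?thesis
    using closest_point_in_set[OF V(2,3)] closest_point_self
    by (auto simp: retraction_def recession_section_def)
qed

lemma recession_section_face:
  assumes "closed S" "convex S" "subspace (recession_cone S)" "T face_of S"
  shows "recession_section T = T \<inter> recession_section S"
proof (cases "T = {}")
  case False
  then show ?thesis
    using recession_cone_face[OF assms(1,2,4) _ assms(3)] face_of_imp_subset[OF assms(4)]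
    by (auto simp: recession_section_def)
qed (simp add: recession_section_def)

lemma recession_section_Int_face:
  assumes S: "closed S" "convex S" "subspace (recession_cone S)"
    and T: "closed T" "convex T" "subspace (recession_cone T)"
    and faces: "S \<inter> T face_of S" "S \<inter> T face_of T"
  shows "recession_section S \<inter> recession_section T face_of recession_section S"
proof -
  have "(S \<inter> T) \<inter> recession_section S = (S \<inter> T) \<inter> recession_section T"
    using recession_section_face[OF S faces(1)] recession_section_face[OF T faces(2)] by simp
  then have "recession_section S \<inter> recession_section T = (S \<inter> T) \<inter> recession_section S"
    using recession_section_subset[of S] recession_section_subset[of T] by blast
  moreover have "(S \<inter> T) \<inter> recession_section S face_of S \<inter> recession_section S"
    using faces(1) convex_recession_section[OF S(2)] by (rule face_of_slice)
  ultimately show ?thesis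
    using recession_section_subset[of S] by (simp add: Int_absorb1)
qed

lemma face_of_recession_sectionE:
  assumes "closed S" "convex S" "subspace (recession_cone S)" "F face_of recession_section S"
  obtains G where "G face_of S" "F = recession_section G"
proof -
  let ?p = "closest_point ((recession_cone S)\<^sup>\<bottom>)"
  have p: "?p ` S \<subseteq> recession_section S" "\<And>x. x \<in> recession_section S \<Longrightarrow> ?p x = x"
    using retraction_recession_section[OF assms(3)] by (auto simp: retraction_def)
  define G where "G = S \<inter> ?p -` F"
  have G: "G face_of S"
    unfolding G_def
    by (intro face_of_linear_vimage[OF _ assms(2) p(1) assms(4)] linear_closest_point_subspace
        subspace_orthogonal_comp)
  have "recession_section G = G \<inter> recession_section S"
    using assms(1-3) G by (rule recession_section_face)
  also have "\<dots> = F"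
    using p(2) face_of_imp_subset[OF assms(4)] recession_section_subset by (fastforce simp: G_def)
  finally show ?thesis
    using that[OF G] by simp
qed

lemma polyhedral_complex_recession_sections:
  assumes M: "polyhedral_complex M" and sub: "\<And>c. c \<in> M \<Longrightarrow> subspace (recession_cone c)"
  shows "polyhedral_complex (recession_section ` M)"
proof -
  note cell = polyhedral_complex_closed_convex[OF M] sub
  have faces: "recession_section c \<inter> recession_section d face_of recession_section c"
    if "c \<in> M" "d \<in> M" for c d
    using polyhedral_complex_Int_face[OF M that]
    by (rule recession_section_Int_face[OF cell[OF that(1)] cell[OF that(2)]])
  show ?thesis
    unfolding polyhedral_complex_def
  proof (intro conjI ballI allI impI)
    show "finite (recession_section ` M)"
      using polyhedral_complex_finite[OF M] by simp
    show "polyhedron C" if "C \<in> recession_section ` M" for C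
      using that polyhedral_complex_polyhedron[OF M] polyhedron_recession_section by blast
    fix C F assume "C \<in> recession_section ` M" "F face_of C"
    then obtain c where c: "c \<in> M" "F face_of recession_section c" by blast
    then obtain G where "G face_of c" "F = recession_section G"
      using face_of_recession_sectionE[OF cell] by blast
    then show "F \<in> recession_section ` M"
      using polyhedral_complex_face[OF M c(1)] by blast
  next
    show "C \<inter> D face_of C" "C \<inter> D face_of D"
      if "C \<in> recession_section ` M" "D \<in> recession_section ` M" for C D
      using that faces by (auto, metis inf_commute)
  qed
qed

lemma homotopy_eqv_recession_sections:
  assumes M: "polyhedral_complex M" and sub: "\<And>c. c \<in> M \<Longrightarrow> subspace (recession_cone c)"
  shows "\<Union>M homotopy_eqv \<Union>(recession_section ` M)"
proof -
  have "(\<Union>c\<in>M. c) homotopy_eqv (\<Union>c\<in>M. recession_section c)"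
  proof (rule homotopy_eqv_UN_retraction)
    show "finite M"
      using M by (rule polyhedral_complex_finite)
  next
    fix c assume c: "c \<in> M"
    show "closed c"
      using polyhedral_complex_closed_convex(1)[OF M c] .
    show retr: "retraction c (recession_section c) (closest_point ((recession_cone c)\<^sup>\<bottom>))"
      using sub[OF c] by (rule retraction_recession_section)
    show "closed_segment x (closest_point ((recession_cone c)\<^sup>\<bottom>) x) \<subseteq> c" if "x \<in> c" for x
      using retr that recession_section_subset polyhedral_complex_closed_convex(2)[OF M c]
      by (intro closed_segment_subset) (auto simp: retraction_def)
    fix d x assume d: "d \<in> M" and "x \<in> c \<inter> d"
    then have "c \<inter> d \<noteq> {}"
      by blast
    then have "recession_cone c = recession_cone d"
      using recession_cone_face[OF polyhedral_complex_closed_convex[OF M c] _ _ sub[OF c]]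
        recession_cone_face[OF polyhedral_complex_closed_convex[OF M d] _ _ sub[OF d]]
        polyhedral_complex_Int_face[OF M c d] by metis
    then show "closest_point ((recession_cone c)\<^sup>\<bottom>) x = closest_point ((recession_cone d)\<^sup>\<bottom>) x"
      by simp
  qed
  then show ?thesis by simp
qed

theorem theorem4p1:
  fixes K :: "(real ^ 'n) set set"
  assumes "polyhedral_complex K"
  shows "\<exists>L :: (real ^ 'n) set set.
           polyhedral_complex L \<and> (\<forall>c\<in>L. bounded c) \<and> card L \<le> card K \<and>
           (\<Union>K) homotopy_eqv (\<Union>L)"
proof -
  obtain M where M: "M \<subseteq> K" "polyhedral_complex M" "\<Union>K homotopy_eqv \<Union>M"
      "\<And>c. c \<in> M \<Longrightarrow> subspace (recession_cone c)"
    using homotopy_eqv_subcomplex_subspace_recession[OF assms] by blast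
  let ?L = "recession_section ` M"
  have "card ?L \<le> card M"
    using polyhedral_complex_finite[OF M(2)] by (rule card_image_le)
  also have "\<dots> \<le> card K"
    using polyhedral_complex_finite[OF assms] M(1) by (rule card_mono)
  finally have "card ?L \<le> card K" .
  moreover have "polyhedral_complex ?L"
    using M(2,4) by (rule polyhedral_complex_recession_sections)
  moreover have "\<forall>c\<in>?L. bounded c"
    using polyhedral_complex_closed_convex[OF M(2)] bounded_recession_section by blast
  moreover have "\<Union>K homotopy_eqv \<Union>?L"
    using M(3) homotopy_eqv_recession_sections[OF M(2,4)] by (rule homotopy_eqv_trans)
  ultimately show ?thesis by blast
qed

end
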